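(* Let $p\ge2$. For any $p$-ary groupoid $\mathbf{A}$ the following hold: (a) $s_0(\mathbf{A})=s_1(\mathbf{A})=1$; (b) $\mathbf{A}$ is associative if and only if $s_n(\mathbf{A})=1$ for all $n\in\mathbb{N}$; (c) for any $n\ge2$: if $s_n(\mathbf{A})=1$, then $s_m(\mathbf{A})=1$ for all $m\in\mathbb{N}$ with $m\ge n$.
   Context: $\mathbb{N}$ includes $0$; $p\ge 2$ is an integer. $T$ is the set of $p$-ary bracketings: terms (prefix notation) over the single variable $x$ and the $p$-ary operation symbol $\omega$, i.e. $x\in T$, and $\omega t_1\ldots t_p\in T$ whenever $t_1,\ldots,t_p\in T$. $B_n^{(p)}$ is the set of bracketings with exactly $n$ occurrences of $\omega$; each contains exactly $(p-1)n+1$ occurrences of $x$. For $t\in T$, $\varepsilon_1(t)$ is the term obtained by replacing the occurrences of $x$ in $t$, from left to right, by distinct variables $x_1,x_2,\ldots$. A $p$-ary groupoid is an algebra $\mathbf{A}$ with one $p$-ary operation. $\sigma_n(\mathbf{A})$ is the equivalence relation on $B_n^{(p)}$ consisting of all $(s,t)$ such that $\mathbf{A}$ satisfies the identity $\varepsilon_1(s)\approx\varepsilon_1(t)$, and $s_n(\mathbf{A})=|B_n^{(p)}/\sigma_n(\mathbf{A})|$ is its number of classes. The sequence $(s_n(\mathbf{A}))_{n\in\mathbb{N}}$ is the associative spectrum of $\mathbf{A}$. $\mathbf{A}$ is called associative iff $s_2(\mathbf{A})=1$. *)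

theory Defs
  imports Main
begin

text \<open>Terms over variables of type \<open>'v\<close> and one operation symbol. The arity is not part of the
  datatype; it is imposed by \<open>T\<close> below.\<close>

datatype 'v pterm = Var 'v | \<omega> "'v pterm list"

text \<open>A bracketing is a term over a single variable, so its variables are drawn from \<open>unit\<close>.\<close>

type_synonym bracketing = "unit pterm"

inductive_set T :: "nat \<Rightarrow> bracketing set" for p :: nat where
  "Var () \<in> T p"
| "length ts = p \<Longrightarrow> (\<forall>t \<in> set ts. t \<in> T p) \<Longrightarrow> \<omega> ts \<in> T p"

primrec num_ops :: "'v pterm \<Rightarrow> nat" where
  "num_ops (Var v) = 0"
| "num_ops (\<omega> ts) = Suc (sum_list (map num_ops ts))"

primrec num_vars :: "'v pterm \<Rightarrow> nat" where
  "num_vars (Var v) = 1"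
| "num_vars (\<omega> ts) = sum_list (map num_vars ts)"

definition B :: "nat \<Rightarrow> nat \<Rightarrow> bracketing set" where
  "B p n = {t \<in> T p. num_ops t = n}"

text \<open>\<open>\<epsilon> k t\<close> replaces the occurrences of the variable in \<open>t\<close>, from left to right, by the variables
  with indices \<open>k, k + 1, k + 2, \<dots>\<close>.\<close>

fun \<epsilon> :: "nat \<Rightarrow> bracketing \<Rightarrow> nat pterm"
  and \<epsilon>_list :: "nat \<Rightarrow> bracketing list \<Rightarrow> nat pterm list" where
  "\<epsilon> k (Var _) = Var k"
| "\<epsilon> k (\<omega> ts) = \<omega> (\<epsilon>_list k ts)"
| "\<epsilon>_list k [] = []"
| "\<epsilon>_list k (t # ts) = \<epsilon> k t # \<epsilon>_list (k + num_vars t) ts"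

text \<open>An operation is a function on lists, of which only the values on lists of length \<open>p\<close> over the
  carrier \<open>A\<close> matter. An empty carrier is not excluded.\<close>

definition groupoid :: "nat \<Rightarrow> 'a set \<Rightarrow> ('a list \<Rightarrow> 'a) \<Rightarrow> bool" where
  "groupoid p A f \<longleftrightarrow> (\<forall>as. length as = p \<and> set as \<subseteq> A \<longrightarrow> f as \<in> A)"

primrec eval_term :: "('a list \<Rightarrow> 'a) \<Rightarrow> ('v \<Rightarrow> 'a) \<Rightarrow> 'v pterm \<Rightarrow> 'a" where
  "eval_term f h (Var v) = h v"
| "eval_term f h (\<omega> ts) = f (map (eval_term f h) ts)"

definition satisfies :: "'a set \<Rightarrow> ('a list \<Rightarrow> 'a) \<Rightarrow> 'v pterm \<Rightarrow> 'v pterm \<Rightarrow> bool" where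
  "satisfies A f s t \<longleftrightarrow> (\<forall>h. (\<forall>v. h v \<in> A) \<longrightarrow> eval_term f h s = eval_term f h t)"

definition \<sigma> :: "nat \<Rightarrow> 'a set \<Rightarrow> ('a list \<Rightarrow> 'a) \<Rightarrow> nat \<Rightarrow> (bracketing \<times> bracketing) set" where
  "\<sigma> p A f n = {(s, t). s \<in> B p n \<and> t \<in> B p n \<and> satisfies A f (\<epsilon> 1 s) (\<epsilon> 1 t)}"

definition spectrum :: "nat \<Rightarrow> 'a set \<Rightarrow> ('a list \<Rightarrow> 'a) \<Rightarrow> nat \<Rightarrow> nat" where
  "spectrum p A f n = card (B p n // \<sigma> p A f n)"

definition associative :: "nat \<Rightarrow> 'a set \<Rightarrow> ('a list \<Rightarrow> 'a) \<Rightarrow> bool" where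
  "associative p A f \<longleftrightarrow> spectrum p A f 2 = 1"

lemma equiv_\<sigma>: "equiv (B p n) (\<sigma> p A f n)"
  by (rule equivI) (auto simp: \<sigma>_def satisfies_def refl_on_def sym_def trans_def)

text \<open>The set of classes is finite, so \<open>card\<close> in \<open>spectrum\<close> does count it.\<close>

lemma finite_B: "finite (B p n)"
proof (induction n rule: less_induct)
  case (less n)
  have "B p n \<subseteq> insert (Var ()) (\<omega> ` {ts. set ts \<subseteq> (\<Union>k<n. B p k) \<and> length ts = p})"
  proof
    fix t assume t: "t \<in> B p n"
    hence "t \<in> T p" and n: "num_ops t = n" by (auto simp: B_def)
    thus "t \<in> insert (Var ()) (\<omega> ` {ts. set ts \<subseteq> (\<Union>k<n. B p k) \<and> length ts = p})"
    proof cases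
      case (2 ts)
      have "u \<in> (\<Union>k<n. B p k)" if u: "u \<in> set ts" for u
      proof -
        have "num_ops u \<le> sum_list (map num_ops ts)"
          using u by (intro member_le_sum_list) auto
        thus ?thesis using 2 n u by (auto simp: B_def)
      qed
      thus ?thesis using 2 by auto
    qed simp
  qed
  moreover have "finite (\<Union>k<n. B p k)" using less by auto
  ultimately show ?case
    by (rule finite_subset[OF _ finite.insertI[OF finite_imageI[OF finite_lists_length_eq]]])
qed

lemma finite_classes: "finite (B p n // \<sigma> p A f n)"
  by (rule finite_quotient[OF finite_B]) (auto simp: \<sigma>_def)

end

theory Submission
  imports Defs
begin

text \<open>Suppose that all bracketings with \<open>n \<ge> 2\<close> operations are equivalent. Let \<open>C i\<close> be the set of
  bracketings obtained from some bracketing with \<open>n\<close> operations by substituting \<open>\<omega> x \<dots> x\<close> for the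
  leaf number \<open>i\<close>, and let \<open>D k\<close> be the set of bracketings \<open>\<omega> x \<dots> v \<dots> x\<close> with a bracketing \<open>v\<close>
  with \<open>n\<close> operations as argument number \<open>k\<close> (both counted from 0). Each \<open>C i\<close> and each \<open>D k\<close>
  lies in one equivalence class, and the sets \<open>C i\<close> cover all bracketings with \<open>n + 1\<close> operations.
  If \<open>k \<le> i \<le> k + (p - 1) (n - 1)\<close>, then \<open>C i\<close> meets \<open>D k\<close>: expand a leaf of the argument \<open>v\<close>.
  Since \<open>n \<ge> 2\<close>, the index \<open>i = k + 1\<close> is admissible for both \<open>k\<close> and \<open>k + 1\<close>, so all \<open>D k\<close> lie in
  the same class, and every \<open>C i\<close> meets some \<open>D k\<close>.\<close>

section \<open>Values of terms with consecutively numbered variables\<close>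

lemma \<epsilon>_list_append:
  "\<epsilon>_list k (xs @ ys) = \<epsilon>_list k xs @ \<epsilon>_list (k + sum_list (map num_vars xs)) ys"
  by (induction xs arbitrary: k) (auto simp: add.assoc)

lemma \<epsilon>_list_replicate_Var: "\<epsilon>_list k (replicate p (Var ())) = map Var [k..<k + p]"
proof (induction p arbitrary: k)
  case (Suc p)
  have "[k..<k + Suc p] = k # [Suc k..<Suc k + p]"
    by (subst upt_conv_Cons) auto
  with Suc[of "Suc k"] show ?case by simp
qed simp

text \<open>Only the window of indices from \<open>k\<close> to \<open>k + num_vars t - 1\<close>
  occurs in \<open>\<epsilon> k t\<close>. The starting indices may differ because an expansion
  shifts the numbering of all later arguments.\<close>

lemma eval_\<epsilon>_cong:
  "(\<And>v. v < num_vars t \<Longrightarrow> h (k + v) = h' (k' + v)) \<Longrightarrow>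
    eval_term f h (\<epsilon> k t) = eval_term f h' (\<epsilon> k' t)"
  and eval_\<epsilon>_list_cong:
  "(\<And>v. v < sum_list (map num_vars ts) \<Longrightarrow> h (k + v) = h' (k' + v)) \<Longrightarrow>
    map (eval_term f h) (\<epsilon>_list k ts) = map (eval_term f h') (\<epsilon>_list k' ts)"
proof (induction k t and k ts arbitrary: k' and k' rule: \<epsilon>_\<epsilon>_list.induct)
  case (1 k u)
  then show ?case by simp
next
  case (2 k ts)
  have "map (eval_term f h) (\<epsilon>_list k ts) = map (eval_term f h') (\<epsilon>_list k' ts)"
    by (rule 2(1)) (use 2(2) in simp)
  then show ?case by simp
next
  case (3 k)
  then show ?case by simp
next
  case (4 k t ts)
  have "eval_term f h (\<epsilon> k t) = eval_term f h' (\<epsilon> k' t)"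
    by (rule 4(1)) (use 4(3) in simp)
  moreover have "map (eval_term f h) (\<epsilon>_list (k + num_vars t) ts) =
      map (eval_term f h') (\<epsilon>_list (k' + num_vars t) ts)"
    by (rule 4(2)) (use 4(3)[of "num_vars t + v" for v] in \<open>simp add: add.assoc\<close>)
  ultimately show ?case by simp
qed

lemma satisfies_\<epsilon>_shift:
  assumes "satisfies A f (\<epsilon> j s) (\<epsilon> j t)"
  shows "satisfies A f (\<epsilon> k s) (\<epsilon> k t)"
  unfolding satisfies_def
proof (intro allI impI)
  fix h :: "nat \<Rightarrow> _" assume h: "\<forall>v. h v \<in> A"
  \<comment> \<open>The index \<open>j + v\<close> receives the value \<open>h (k + v)\<close>. By
    truncated subtraction, indices below \<open>j\<close> receive \<open>h k\<close>, so the new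
    assignment stays in \<open>A\<close>.\<close>
  have eq: "eval_term f h (\<epsilon> k u) = eval_term f (\<lambda>v. h (v - j + k)) (\<epsilon> j u)" for u
    by (rule eval_\<epsilon>_cong) (simp add: add.commute)
  show "eval_term f h (\<epsilon> k s) = eval_term f h (\<epsilon> k t)"
    unfolding eq using assms h by (simp add: satisfies_def)
qed

lemma satisfies_sym: "satisfies A f s t \<Longrightarrow> satisfies A f t s"
  by (simp add: satisfies_def)

lemma satisfies_trans: "satisfies A f s t \<Longrightarrow> satisfies A f t u \<Longrightarrow> satisfies A f s u"
  by (simp add: satisfies_def)

section \<open>Numbers of leaves and operations\<close>

lemma \<omega>_in_T_iff: "\<omega> ts \<in> T p \<longleftrightarrow> length ts = p \<and> set ts \<subseteq> T p"
  by (auto elim: T.cases intro: T.intros)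

lemma num_vars_T:
  assumes "t \<in> T p" "p > 0"
  shows "num_vars t = (p - 1) * num_ops t + 1"
  using assms(1)
proof induction
  case (2 ts)
  have "sum_list (map num_vars ts) = (p - 1) * sum_list (map num_ops ts) + length ts"
    using 2(2) by (induction ts) (auto simp: algebra_simps)
  with 2(1) assms(2) show ?case by (cases p) (simp_all add: algebra_simps)
qed simp

lemma num_vars_B: "t \<in> B p n \<Longrightarrow> p > 0 \<Longrightarrow> num_vars t = (p - 1) * n + 1"
  by (auto simp: B_def num_vars_T)

section \<open>Expanding one leaf\<close>

text \<open>The set \<open>C i\<close> of the outline consists of all \<open>t\<close> with
  \<open>expands p u i t\<close> for some \<open>u \<in> B p n\<close>.\<close>

inductive expands :: "nat \<Rightarrow> bracketing \<Rightarrow> nat \<Rightarrow> bracketing \<Rightarrow> bool" for p where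
  leaf: "expands p (Var ()) 0 (\<omega> (replicate p (Var ())))"
| node: "expands p u i t \<Longrightarrow>
    expands p (\<omega> (xs @ u # ys)) (sum_list (map num_vars xs) + i) (\<omega> (xs @ t # ys))"

lemma expands_less_num_vars: "expands p u i t \<Longrightarrow> i < num_vars u"
  by (induction rule: expands.induct) auto

lemma expands_num_vars: "expands p u i t \<Longrightarrow> Suc (num_vars t) = num_vars u + p"
  by (induction rule: expands.induct) (auto simp: map_replicate_const sum_list_replicate)

lemma expands_num_ops: "expands p u i t \<Longrightarrow> num_ops t = Suc (num_ops u)"
  by (induction rule: expands.induct) (auto simp: map_replicate_const sum_list_replicate)

lemma expands_T_iff: "expands p u i t \<Longrightarrow> t \<in> T p \<longleftrightarrow> u \<in> T p"
  by (induction rule: expands.induct) (auto simp: \<omega>_in_T_iff T.intros(1))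

lemma expands_B_iff: "expands p u i t \<Longrightarrow> t \<in> B p (Suc n) \<longleftrightarrow> u \<in> B p n"
  by (auto simp: B_def expands_T_iff expands_num_ops)

lemma expands_exists:
  assumes "i < num_vars u"
  obtains t where "expands p u i t"
proof -
  have "\<exists>t. expands p u i t" using assms
  proof (induction u arbitrary: i)
    case (Var x)
    then show ?case using expands.leaf by auto
  next
    case (\<omega> ts)
    \<comment> \<open>Leaf \<open>i\<close> lies in a unique argument \<open>u\<close>; subtracting
      the leaves of the earlier arguments \<open>xs\<close> leaves its position \<open>j\<close> in
      \<open>u\<close>.\<close>
    have "\<exists>xs u ys j. ts = xs @ u # ys \<and> i = sum_list (map num_vars xs) + j \<and> j < num_vars u"
      using \<omega>(2)
    proof (induction ts arbitrary: i)
      case (Cons t ts)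
      show ?case
      proof (cases "i < num_vars t")
        case True
        then show ?thesis by (intro exI[of _ "[]"]) auto
      next
        case False
        then have "i - num_vars t < num_vars (\<omega> ts)" using Cons(2) by auto
        from Cons(1)[OF this] obtain xs u ys j where
          "ts = xs @ u # ys" "i - num_vars t = sum_list (map num_vars xs) + j" "j < num_vars u"
          by blast
        with False show ?thesis by (intro exI[of _ "t # xs"] exI[of _ u] exI[of _ ys] exI[of _ j]) auto
      qed
    qed simp
    with \<omega>(1) show ?case by (fastforce intro: expands.node)
  qed
  with that show ?thesis by blast
qed

text \<open>Descending into arguments other than a leaf ends at an operation symbol applied to
  leaves only, which can be contracted. Hence the sets \<open>C i\<close> cover all bracketings with
  \<open>n + 1\<close> operations.\<close>

lemma T_expands_cases:
  assumes "t \<in> T p"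
  obtains "t = Var ()" | u i where "expands p u i t"
proof -
  have "t = Var () \<or> (\<exists>u i. expands p u i t)" using assms
  proof induction
    case (2 ts)
    show ?case
    proof (cases "set ts \<subseteq> {Var ()}")
      case True
      then have "ts = replicate p (Var ())" using 2(1) by (auto intro: replicate_eqI)
      then show ?thesis using expands.leaf by auto
    next
      case False
      then obtain t where "t \<in> set ts" "t \<noteq> Var ()" by auto
      with 2(2) obtain xs ys u i where "ts = xs @ t # ys" "expands p u i t"
        by (meson split_list)
      then show ?thesis using expands.node by blast
    qed
  qed simp
  with that show ?thesis by blast
qed

lemma B_nonempty:
  assumes "p > 0"
  shows "B p n \<noteq> {}"
proof (induction n)
  case 0
  have "Var () \<in> B p 0" by (simp add: B_def T.intros)
  then show ?case by blast
next
  case (Suc n)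
  then obtain u where u: "u \<in> B p n" by blast
  then have "0 < num_vars u" using assms by (simp add: num_vars_B)
  then obtain t where "expands p u 0 t" by (rule expands_exists)
  with u show ?case using expands_B_iff by blast
qed

lemma B_0: "B p 0 = {Var ()}"
  by (auto simp: B_def intro: T.intros elim: T.cases)

section \<open>Expansion preserves identities\<close>

text \<open>The assignment under which the unexpanded term has the value of the expanded one: the
  new leaves occupy \<open>i\<close> to \<open>i + p - 1\<close>, so a later variable
  \<open>v\<close> becomes \<open>v + p - 1\<close>.\<close>

definition contract :: "nat \<Rightarrow> ('a list \<Rightarrow> 'a) \<Rightarrow> nat \<Rightarrow> (nat \<Rightarrow> 'a) \<Rightarrow> nat \<Rightarrow> 'a" where
  "contract p f i h v =
    (if v < i then h v else if v = i then f (map h [i..<i + p]) else h (v + p - 1))"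

lemma contract_in_carrier:
  assumes "groupoid p A f" "\<And>v. h v \<in> A"
  shows "contract p f i h v \<in> A"
proof -
  have "f (map h [i..<i + p]) \<in> A"
    using assms unfolding groupoid_def by (metis (no_types) length_map length_upt
      add_diff_cancel_left' imageE set_map subsetI)
  with assms(2) show ?thesis by (simp add: contract_def)
qed

lemma eval_expands:
  "expands p u i t \<Longrightarrow>
    eval_term f h (\<epsilon> k t) = eval_term f (contract p f (k + i) h) (\<epsilon> k u)"
proof (induction arbitrary: k rule: expands.induct)
  case leaf
  have "eval_term f h \<circ> Var = h" by auto
  then show ?case by (simp add: \<epsilon>_list_replicate_Var contract_def)
next
  case (node u i t xs ys)
  let ?m = "sum_list (map num_vars xs)"
  let ?h = "contract p f (k + (?m + i)) h"
  have "map (eval_term f h) (\<epsilon>_list k xs) = map (eval_term f ?h) (\<epsilon>_list k xs)"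
    by (rule eval_\<epsilon>_list_cong) (simp add: contract_def)
  moreover have "eval_term f h (\<epsilon> (k + ?m) t) = eval_term f ?h (\<epsilon> (k + ?m) u)"
    using node.IH[of "k + ?m"] by (simp add: add.assoc)
  moreover have "map (eval_term f h) (\<epsilon>_list (k + ?m + num_vars t) ys) =
      map (eval_term f ?h) (\<epsilon>_list (k + ?m + num_vars u) ys)"
  proof (rule eval_\<epsilon>_list_cong)
    fix v
    \<comment> \<open>The growth of the leaf count in an expansion matches the shift in
      \<open>contract\<close>.\<close>
    have "k + ?m + num_vars u + v + p - 1 = k + ?m + num_vars t + v"
      using expands_num_vars[OF node.hyps] by linarith
    with expands_less_num_vars[OF node.hyps]
    show "h (k + ?m + num_vars t + v) = ?h (k + ?m + num_vars u + v)"
      by (simp add: contract_def)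
  qed
  ultimately show ?case by (simp add: \<epsilon>_list_append del: map_eq_conv)
qed

text \<open>The contracted assignment depends on the position \<open>i\<close> but not on the term,
  so the same one serves \<open>u\<close> and \<open>u'\<close>. Hence \<open>C i\<close> lies in
  one class.\<close>

lemma satisfies_expands:
  assumes "groupoid p A f" "satisfies A f (\<epsilon> k u) (\<epsilon> k u')"
    and "expands p u i t" "expands p u' i t'"
  shows "satisfies A f (\<epsilon> k t) (\<epsilon> k t')"
  using assms(2) contract_in_carrier[OF assms(1)]
  by (auto simp: satisfies_def eval_expands[OF assms(3)] eval_expands[OF assms(4)])

section \<open>Bracketings with one distinguished argument\<close>

definition wrap :: "nat \<Rightarrow> nat \<Rightarrow> bracketing \<Rightarrow> bracketing" where
  "wrap p k v = \<omega> (replicate k (Var ()) @ v # replicate (p - Suc k) (Var ()))"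

lemma wrap_B: "k < p \<Longrightarrow> v \<in> B p n \<Longrightarrow> wrap p k v \<in> B p (Suc n)"
  by (auto simp: wrap_def B_def \<omega>_in_T_iff T.intros(1) map_replicate_const sum_list_replicate)

lemma wrap_expands: "expands p u i t \<Longrightarrow> expands p (wrap p k u) (k + i) (wrap p k t)"
  using expands.node[of p u i t "replicate k (Var ())"]
  by (simp add: wrap_def map_replicate_const sum_list_replicate)

text \<open>Equal leaf counts give the leaves after the argument the same variables on both sides.
  Hence each set \<open>D k\<close> of the outline lies in one class.\<close>

lemma satisfies_wrap:
  assumes "satisfies A f (\<epsilon> 1 s) (\<epsilon> 1 t)" "num_vars s = num_vars t"
  shows "satisfies A f (\<epsilon> 1 (wrap p k s)) (\<epsilon> 1 (wrap p k t))"
  using satisfies_\<epsilon>_shift[OF assms(1)] assms(2)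
  by (simp add: satisfies_def wrap_def \<epsilon>_list_append)

section \<open>Spectrum value 1 and the indices 0 and 1\<close>

lemma spectrum_eq_1_iff:
  assumes "p > 0"
  shows "spectrum p A f n = 1 \<longleftrightarrow>
    (\<forall>s\<in>B p n. \<forall>t\<in>B p n. satisfies A f (\<epsilon> 1 s) (\<epsilon> 1 t))"
  (is "_ \<longleftrightarrow> ?R")
proof
  assume "spectrum p A f n = 1"
  then obtain X where X: "B p n // \<sigma> p A f n = {X}"
    unfolding spectrum_def by (rule card_1_singletonE)
  show ?R
  proof (intro ballI)
    fix s t assume st: "s \<in> B p n" "t \<in> B p n"
    then have "\<sigma> p A f n `` {s} = \<sigma> p A f n `` {t}"
      using X quotientI by (metis singletonD)
    then have "(s, t) \<in> \<sigma> p A f n"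
      using st by (simp add: eq_equiv_class_iff[OF equiv_\<sigma>])
    then show "satisfies A f (\<epsilon> 1 s) (\<epsilon> 1 t)" by (simp add: \<sigma>_def)
  qed
next
  assume ?R
  then have "B p n // \<sigma> p A f n = {B p n}"
    using B_nonempty[OF assms, of n] by (auto simp: quotient_def \<sigma>_def)
  then show "spectrum p A f n = 1" by (simp add: spectrum_def)
qed

lemma spectrum_0: "p > 0 \<Longrightarrow> spectrum p A f 0 = 1"
  unfolding spectrum_eq_1_iff by (auto simp: B_0 satisfies_def)

lemma B_1: "B p 1 \<subseteq> {\<omega> (replicate p (Var ()))}"
proof
  fix t assume t: "t \<in> B p 1"
  then have "t \<noteq> Var ()" by (auto simp: B_def)
  with t obtain u i where e: "expands p u i t" by (auto simp: B_def elim: T_expands_cases)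
  with t have "u \<in> B p 0" by (simp add: expands_B_iff)
  with e show "t \<in> {\<omega> (replicate p (Var ()))}" by (auto simp: B_0 elim: expands.cases)
qed

lemma spectrum_1:
  assumes "p > 0"
  shows "spectrum p A f 1 = 1"
proof -
  have "s = t" if "s \<in> B p 1" "t \<in> B p 1" for s t
    using that B_1 by blast
  then show ?thesis unfolding spectrum_eq_1_iff[OF assms] by (auto simp: satisfies_def)
qed

section \<open>The step from \<open>n\<close> to \<open>n + 1\<close>\<close>

lemma spectrum_Suc_eq_1:
  assumes p: "p \<ge> 2" and A: "groupoid p A f" and n: "n \<ge> 2" and "spectrum p A f n = 1"
  shows "spectrum p A f (Suc n) = 1"
proof -
  have p0: "p > 0" using p by simp
  let ?eq = "\<lambda>s t. satisfies A f (\<epsilon> 1 s) (\<epsilon> 1 t)"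
  have triv: "?eq s t" if "s \<in> B p n" "t \<in> B p n" for s t
    using assms(4) that unfolding spectrum_eq_1_iff[OF p0] by blast
  obtain m where m: "n = Suc m" "m \<ge> 1" using n by (cases n) auto
  have pm: "1 \<le> (p - 1) * m" using p m(2) by simp
  obtain v where v: "v \<in> B p m" using B_nonempty[OF p0] by blast
  \<comment> \<open>\<open>C i\<close> meets \<open>D k\<close> in \<open>wrap p k v'\<close>: since
    \<open>v\<close> has \<open>(p - 1) * m + 1\<close> leaves, the bounds on \<open>i\<close> say
    that leaf \<open>i\<close> of \<open>wrap p k v\<close> is leaf \<open>i - k\<close> of
    \<open>v\<close>.\<close>
  have eq_wrap: "?eq t (wrap p k w)"
    if "expands p u i t" "u \<in> B p n" "w \<in> B p n" "k < p" "k \<le> i" "i \<le> k + (p - 1) * m"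
    for u i t w k
  proof -
    have "i - k < num_vars v" using that p v by (simp add: num_vars_B)
    then obtain v' where v': "expands p v (i - k) v'" by (rule expands_exists)
    then have v'n: "v' \<in> B p n" using v m by (simp add: expands_B_iff)
    have "expands p (wrap p k v) i (wrap p k v')"
      using wrap_expands[OF v', of k] that by simp
    moreover have "?eq u (wrap p k v)" using triv that wrap_B v m by blast
    ultimately have "?eq t (wrap p k v')" using satisfies_expands A that(1) by blast
    moreover have "?eq (wrap p k v') (wrap p k w)"
      using v'n that p by (intro satisfies_wrap triv) (simp_all add: num_vars_B)
    ultimately show ?thesis by (rule satisfies_trans)
  qed
  obtain w where w: "w \<in> B p n" using B_nonempty[OF p0] by blast
  have wrap_0: "?eq (wrap p k w) (wrap p 0 w)" if "k < p" for k
    using that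
  proof (induction k)
    case 0
    show ?case by (simp add: satisfies_def)
  next
    case (Suc k)
    have "p - 1 \<le> (p - 1) * m" using m(2) by simp
    then have "Suc k < num_vars w"
      using Suc.prems w p m by (simp add: num_vars_B)
    then obtain t where t: "expands p w (Suc k) t" by (rule expands_exists)
    \<comment> \<open>For \<open>k\<close> the bound \<open>k + 1 \<le> k + (p - 1) * m\<close> is
      \<open>pm\<close>, which rests on \<open>n \<ge> 2\<close>; for \<open>Suc k\<close> the index
      is the lower bound itself.\<close>
    have "?eq t (wrap p k w)" by (rule eq_wrap[OF t w w]) (use Suc.prems pm in auto)
    moreover have "?eq t (wrap p (Suc k) w)"
      by (rule eq_wrap[OF t w w]) (use Suc.prems in auto)
    moreover have "?eq (wrap p k w) (wrap p 0 w)" using Suc by simp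
    ultimately show ?case by (meson satisfies_sym satisfies_trans)
  qed
  have to_wrap_0: "?eq t (wrap p 0 w)" if t: "t \<in> B p (Suc n)" for t
  proof -
    have "t \<noteq> Var ()" using t by (auto simp: B_def)
    with t obtain u i where e: "expands p u i t" by (auto simp: B_def elim: T_expands_cases)
    then have u: "u \<in> B p n" using t by (simp add: expands_B_iff)
    have "i \<le> (p - 1) + (p - 1) * m"
      using expands_less_num_vars[OF e] u p m by (simp add: num_vars_B)
    \<comment> \<open>The largest argument position not exceeding \<open>i\<close>; the bound on
      \<open>i\<close> just shown makes it admissible also when it is \<open>p - 1\<close>.\<close>
    then have "?eq t (wrap p (min i (p - 1)) w)"
      using p by (intro eq_wrap[OF e u w]) auto
    then show ?thesis by (rule satisfies_trans) (rule wrap_0, use p in simp)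
  qed
  show ?thesis
    unfolding spectrum_eq_1_iff[OF p0] by (meson to_wrap_0 satisfies_sym satisfies_trans)
qed

theorem theorem3p6:
  fixes p :: nat and A :: "'a set" and f :: "'a list \<Rightarrow> 'a"
  assumes "p \<ge> 2" and "groupoid p A f"
  shows "(spectrum p A f 0 = 1 \<and> spectrum p A f 1 = 1) \<and>
    (associative p A f \<longleftrightarrow> (\<forall>n. spectrum p A f n = 1)) \<and>
    (\<forall>n\<ge>2. spectrum p A f n = 1 \<longrightarrow> (\<forall>m\<ge>n. spectrum p A f m = 1))"
proof -
  have p: "p > 0" using assms(1) by simp
  have up: "spectrum p A f m = 1" if "spectrum p A f n = 1" "2 \<le> n" "n \<le> m" for m n
    using that(3,1)
    by (induction rule: dec_induct)
      (use that(2) assms in \<open>auto intro: spectrum_Suc_eq_1 simp del: One_nat_def\<close>)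
  \<comment> \<open>Associativity is the case \<open>n = 2\<close> of the hypothesis in (c); the
    indices 0 and 1 are covered by (a).\<close>
  have "spectrum p A f n = 1" if "spectrum p A f 2 = 1" for n
  proof -
    consider "n = 0" | "n = 1" | "2 \<le> n" by linarith
    then show ?thesis using spectrum_0[OF p] spectrum_1[OF p] up[OF that] by cases auto
  qed
  then show ?thesis using spectrum_0[OF p] spectrum_1[OF p] up unfolding associative_def by blast
qed

end
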